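(* Let $m\ge2$, let $\mathbb F_q$ be a finite field with $q$ elements, and let $\ell$ be a prime divisor of $m$. Consider the additional coefficient terms in the homotopy groups of $\mathbf R_m(\mathbb F_q)$ (see context): the summand $\mathbb Z/\gcd(m,q^r-1)$ with $r=j$ in odd degree $2j-1$ ($j\ge1$) and with $r=j+1$ in even degree $2j$ ($j\ge0$). (i) If $\ell\mid q$, then all these additional terms have trivial $\ell$-primary part. (ii) If $\ell\nmid q$ and $o_\ell(q)$ is the multiplicative order of $q$ modulo $\ell$, then the $\ell$-primary part of the additional term in degree $2j-1$ is nonzero exactly when $o_\ell(q)\mid j$, and that in degree $2j$ is nonzero exactly when $o_\ell(q)\mid j+1$. (iii) In either nonzero case its order is $\ell^{\min\{v_\ell(m),\,v_\ell(q^r-1)\}}$, with $r=j$ in odd degree $2j-1$ and $r=j+1$ in even degree $2j$. Consequently the additional summands are nonzero precisely when $\gcd(m,q^r-1)>1$.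
   Context: $v_\ell$ is the $\ell$-adic valuation. Write $k=\mathbb F_q$ and $C_m=\mathbb Z/m$. $\mathcal T_m(k)$ is $A=k^{C_m}$ (functions with pointwise multiplication, $\varepsilon_t$ the characteristic function of $t$) with automorphism $\sigma(\varepsilon_t)=\varepsilon_{t+1}$ and totally associative $(m+1)$-ary product $\mu(a_0,\ldots,a_m)=a_0\sigma(a_1)\cdots\sigma^{m-1}(a_{m-1})a_m$. A slot module over it is a $k$-module $M$ with multilinear maps $\lambda_i:A^{\otimes i}\otimes M\otimes A^{\otimes(m-i)}\to M$, $0\le i\le m$, such that all evaluations of a planar $(m+1)$-ary word containing exactly one entry of $M$ agree under total-associativity moves; it is anchored if $\lambda_0(x,1,\ldots,1)=x$ and $\lambda_m(1,\ldots,1,x)=x$ for all $x$. $\mathcal M_m(k)$ is the exact category of finite-dimensional anchored slot modules, and $\mathbf R_m(k)$ is the homotopy fibre (in spectra) of the map of connective Quillen $K$-theory spectra $\mathbf K(\mathcal M_m(k))\to\mathbf K(k)$ induced by the forgetful functor to finite-dimensional vector spaces. With $g_j=\gcd(m,q^j-1)$, its homotopy groups in nonnegative degrees are $\pi_0\cong\mathbb Z^{m-1}\oplus\mathbb Z/g_1$, $\pi_{2j-1}\cong(\mathbb Z/(q^j-1))^{m-1}\oplus\mathbb Z/g_j$ and $\pi_{2j}\cong\mathbb Z/g_{j+1}$ for $j\ge1$. The "additional coefficient terms" are the summands $\mathbb Z/g_1$ in degree $0$, $\mathbb Z/g_j$ in degree $2j-1$, and $\mathbb Z/g_{j+1}$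 in degree $2j$. *)

theory Defs
  imports
    "HOL-Homology.Homology"
    "HOL-Number_Theory.Number_Theory"
    "HOL-Algebra.Product_Groups"
    "Jordan_Normal_Form.Matrix"
begin

section \<open>Slot modules\<close>

text \<open>Functions on \<open>\<int>/m\<close> are represented as \<open>m\<close>-periodic functions on the integers.\<close>

definition cyc_fun :: "nat \<Rightarrow> (int \<Rightarrow> 'k::field) set" where
  "cyc_fun m = {a. \<forall>t. a (t + int m) = a t}"

text \<open>The automorphism with \<open>\<sigma>(\<epsilon>\<^sub>t) = \<epsilon>\<^sub>t\<^sub>+\<^sub>1\<close>.\<close>

definition cyc_shift :: "(int \<Rightarrow> 'k::field) \<Rightarrow> int \<Rightarrow> 'k" where
  "cyc_shift a = (\<lambda>t. a (t - 1))"

text \<open>The product \<open>a\<^sub>0 \<sigma>(a\<^sub>1) \<dots> \<sigma>\<^sup>m\<^sup>-\<^sup>1(a\<^sub>m\<^sub>-\<^sub>1) a\<^sub>m\<close> of a list of length \<open>m + 1\<close>.\<close>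

definition tm_prod :: "nat \<Rightarrow> (int \<Rightarrow> 'k::field) list \<Rightarrow> int \<Rightarrow> 'k" where
  "tm_prod m as = (\<lambda>t. (\<Prod>i<m. (cyc_shift ^^ i) (as ! i) t) * (as ! m) t)"

text \<open>Planar bracketings of a word, and their evaluation by an operation taking
  the list of the values of the children of a node.\<close>

datatype 'e planar = Leaf 'e | Node "'e planar list"

primrec planar_word :: "'e planar \<Rightarrow> 'e list" where
  "planar_word (Leaf e) = [e]"
| "planar_word (Node ts) = concat (map planar_word ts)"

primrec planar_eval :: "('e list \<Rightarrow> 'e) \<Rightarrow> 'e planar \<Rightarrow> 'e" where
  "planar_eval f (Leaf e) = e"
| "planar_eval f (Node ts) = f (map (planar_eval f) ts)"

fun planar_ary :: "nat \<Rightarrow> 'e planar \<Rightarrow> bool" where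
  "planar_ary n (Leaf e) \<longleftrightarrow> True"
| "planar_ary n (Node ts) \<longleftrightarrow> length ts = n \<and> (\<forall>t\<in>set ts. planar_ary n t)"

text \<open>The underlying space of a slot module is a coordinate space \<open>k\<^sup>n\<close>; every
  finite-dimensional slot module is isomorphic to one of this form. The value \<open>lam i as x\<close> is
  \<open>\<lambda>\<^sub>i(a\<^sub>0, \<dots>, a\<^sub>i\<^sub>-\<^sub>1, x, a\<^sub>i, \<dots>, a\<^sub>m\<^sub>-\<^sub>1)\<close> where \<open>as = [a\<^sub>0, \<dots>, a\<^sub>m\<^sub>-\<^sub>1]\<close>. Values of \<open>lam\<close> on
  arguments outside the intended domain are irrelevant: two slot modules that differ only there
  are isomorphic through the identity matrix.\<close>

type_synonym 'k slot_data = "nat \<times> (nat \<Rightarrow> (int \<Rightarrow> 'k) list \<Rightarrow> 'k Matrix.vec \<Rightarrow> 'k Matrix.vec)"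

definition slot_words :: "nat \<Rightarrow> (int \<Rightarrow> 'k::field) list set" where
  "slot_words m = {as. length as = m \<and> set as \<subseteq> cyc_fun m}"

text \<open>Evaluation of an \<open>(m+1)\<close>-ary node; entries of the algebra are tagged \<open>Inl\<close>, entries of
  the module \<open>Inr\<close>. It is only used for nodes with at most one module entry.\<close>

definition slot_op ::
  "nat \<Rightarrow> (nat \<Rightarrow> (int \<Rightarrow> 'k::field) list \<Rightarrow> 'k Matrix.vec \<Rightarrow> 'k Matrix.vec)
    \<Rightarrow> ((int \<Rightarrow> 'k) + 'k Matrix.vec) list \<Rightarrow> (int \<Rightarrow> 'k) + 'k Matrix.vec" where
  "slot_op m lam es =
    (if \<forall>e\<in>set es. isl e then Inl (tm_prod m (map projl es))
     else let i = (LEAST i. i < length es \<and> \<not> isl (es ! i))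
          in Inr (lam i (map projl (take i es @ drop (Suc i) es)) (projr (es ! i))))"

definition slot_multilinear :: "nat \<Rightarrow> 'k::field slot_data \<Rightarrow> bool" where
  "slot_multilinear m M \<longleftrightarrow> (case M of (n, lam) \<Rightarrow>
    \<forall>i\<le>m. \<forall>as\<in>slot_words m. \<forall>x\<in>carrier_vec n.
      lam i as x \<in> carrier_vec n \<and>
      (\<forall>c. \<forall>y\<in>carrier_vec n.
        lam i as (c \<cdot>\<^sub>v x + y) = c \<cdot>\<^sub>v lam i as x + lam i as y) \<and>
      (\<forall>j<m. \<forall>c. \<forall>a\<in>cyc_fun m. \<forall>b\<in>cyc_fun m.
        lam i (as[j := (\<lambda>t. c * a t + b t)]) x
          = c \<cdot>\<^sub>v lam i (as[j := a]) x + lam i (as[j := b]) x))"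

definition slot_associative :: "nat \<Rightarrow> 'k::field slot_data \<Rightarrow> bool" where
  "slot_associative m M \<longleftrightarrow> (case M of (n, lam) \<Rightarrow>
    \<forall>s t. planar_ary (Suc m) s \<and> planar_ary (Suc m) t \<and> planar_word s = planar_word t \<and>
      set (planar_word s) \<subseteq> Inl ` cyc_fun m \<union> Inr ` carrier_vec n \<and>
      length (filter (\<lambda>e. \<not> isl e) (planar_word s)) = 1
      \<longrightarrow> planar_eval (slot_op m lam) s = planar_eval (slot_op m lam) t)"

definition slot_anchored :: "nat \<Rightarrow> 'k::field slot_data \<Rightarrow> bool" where
  "slot_anchored m M \<longleftrightarrow> (case M of (n, lam) \<Rightarrow>
    \<forall>x\<in>carrier_vec n. lam 0 (replicate m (\<lambda>_. 1)) x = x \<and> lam m (replicate m (\<lambda>_. 1)) x = x)"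

definition slot_hom :: "nat \<Rightarrow> 'k::field slot_data \<Rightarrow> 'k slot_data \<Rightarrow> 'k mat set" where
  "slot_hom m M N = (case M of (n, lam) \<Rightarrow> case N of (n', lam') \<Rightarrow>
    {F \<in> carrier_mat n' n. \<forall>i\<le>m. \<forall>as\<in>slot_words m. \<forall>x\<in>carrier_vec n.
      F *\<^sub>v lam i as x = lam' i as (F *\<^sub>v x)})"

section \<open>Exact categories\<close>

text \<open>\<open>econf E X Y Z f g\<close> says that \<open>X \<rightarrow> Y \<rightarrow> Z\<close> is one of the distinguished short exact
  sequences; \<open>ecomp E g f\<close> is \<open>g\<close> after \<open>f\<close>.\<close>

record ('o, 'a) exact_cat =
  eob :: "'o set"
  ehom :: "'o \<Rightarrow> 'o \<Rightarrow> 'a set"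
  ecomp :: "'a \<Rightarrow> 'a \<Rightarrow> 'a"
  eid :: "'o \<Rightarrow> 'a"
  ezero :: "'o"
  econf :: "'o \<Rightarrow> 'o \<Rightarrow> 'o \<Rightarrow> 'a \<Rightarrow> 'a \<Rightarrow> bool"

definition short_exact_mat ::
  "nat \<Rightarrow> nat \<Rightarrow> nat \<Rightarrow> 'k::field mat \<Rightarrow> 'k mat \<Rightarrow> bool" where
  "short_exact_mat n1 n2 n3 F G \<longleftrightarrow>
    F \<in> carrier_mat n2 n1 \<and> G \<in> carrier_mat n3 n2 \<and>
    inj_on (\<lambda>x. F *\<^sub>v x) (carrier_vec n1) \<and>
    (\<lambda>x. F *\<^sub>v x) ` carrier_vec n1 = {y \<in> carrier_vec n2. G *\<^sub>v y = 0\<^sub>v n3} \<and>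
    (\<lambda>y. G *\<^sub>v y) ` carrier_vec n2 = carrier_vec n3"

definition slot_cat :: "nat \<Rightarrow> ('k::field slot_data, 'k mat) exact_cat" where
  "slot_cat m = \<lparr>
    eob = {M. slot_multilinear m M \<and> slot_associative m M \<and> slot_anchored m M},
    ehom = slot_hom m,
    ecomp = (\<lambda>G F. G * F),
    eid = (\<lambda>M. 1\<^sub>m (fst M)),
    ezero = (0, \<lambda>_ _ _. 0\<^sub>v 0),
    econf = (\<lambda>L M N F G. F \<in> slot_hom m L M \<and> G \<in> slot_hom m M N \<and>
      short_exact_mat (fst L) (fst M) (fst N) F G)\<rparr>"

definition vect_cat :: "(nat, 'k::field mat) exact_cat" where
  "vect_cat = \<lparr>
    eob = UNIV,
    ehom = (\<lambda>n n'. carrier_mat n' n),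
    ecomp = (\<lambda>G F. G * F),
    eid = (\<lambda>n. 1\<^sub>m n),
    ezero = 0,
    econf = short_exact_mat\<rparr>"

definition inflation :: "('o, 'a) exact_cat \<Rightarrow> 'o \<Rightarrow> 'o \<Rightarrow> 'a \<Rightarrow> bool" where
  "inflation E X Y f \<longleftrightarrow> (\<exists>Z\<in>eob E. \<exists>g. econf E X Y Z f g)"

definition deflation :: "('o, 'a) exact_cat \<Rightarrow> 'o \<Rightarrow> 'o \<Rightarrow> 'a \<Rightarrow> bool" where
  "deflation E Y Z g \<longleftrightarrow> (\<exists>X\<in>eob E. \<exists>f. econf E X Y Z f g)"

definition exact_iso :: "('o, 'a) exact_cat \<Rightarrow> 'o \<Rightarrow> 'o \<Rightarrow> 'a \<Rightarrow> bool" where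
  "exact_iso E X Y u \<longleftrightarrow> u \<in> ehom E X Y \<and>
    (\<exists>v\<in>ehom E Y X. ecomp E v u = eid E X \<and> ecomp E u v = eid E Y)"

text \<open>\<open>P\<close> with projections \<open>a\<close>, \<open>b\<close> is a pullback of \<open>f\<close>, \<open>g\<close> with sources \<open>Z\<close>, \<open>Z'\<close>
  and common target.\<close>

definition is_pullback ::
  "('o, 'a) exact_cat \<Rightarrow> 'o \<Rightarrow> 'o \<Rightarrow> 'a \<Rightarrow> 'a \<Rightarrow> 'o \<Rightarrow> 'a \<Rightarrow> 'a \<Rightarrow> bool" where
  "is_pullback E Z Z' f g P a b \<longleftrightarrow>
    P \<in> eob E \<and> a \<in> ehom E P Z \<and> b \<in> ehom E P Z' \<and> ecomp E f a = ecomp E g b \<and>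
    (\<forall>T\<in>eob E. \<forall>u\<in>ehom E T Z. \<forall>v\<in>ehom E T Z'. ecomp E f u = ecomp E g v \<longrightarrow>
      (\<exists>!w. w \<in> ehom E T P \<and> ecomp E a w = u \<and> ecomp E b w = v))"

section \<open>Quillen's Q-construction\<close>

record ('o, 'a) small_cat =
  cob :: "'o set"
  chom :: "'o \<Rightarrow> 'o \<Rightarrow> 'a set"
  ccomp :: "'a \<Rightarrow> 'a \<Rightarrow> 'a"
  cid :: "'o \<Rightarrow> 'a"

text \<open>A morphism from \<open>X\<close> to \<open>Y\<close> in the Q-construction is an isomorphism class of triples
  \<open>(Z, p, i)\<close> with a deflation \<open>p : Z \<rightarrow> X\<close> and an inflation \<open>i : Z \<rightarrow> Y\<close>. The
  composite of two classes consists of all spans formed through some pullback; this set is again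
  an isomorphism class.\<close>

definition q_spans :: "('o, 'a) exact_cat \<Rightarrow> 'o \<Rightarrow> 'o \<Rightarrow> ('o \<times> 'a \<times> 'a) set" where
  "q_spans E X Y = {(Z, p, i). Z \<in> eob E \<and> deflation E Z X p \<and> inflation E Z Y i}"

definition q_class ::
  "('o, 'a) exact_cat \<Rightarrow> 'o \<Rightarrow> 'o \<Rightarrow> 'o \<times> 'a \<times> 'a \<Rightarrow> ('o \<times> 'a \<times> 'a) set" where
  "q_class E X Y s = (case s of (Z, p, i) \<Rightarrow>
    {(Z', p', i'). (Z', p', i') \<in> q_spans E X Y \<and>
      (\<exists>u. exact_iso E Z Z' u \<and> ecomp E p' u = p \<and> ecomp E i' u = i)})"

definition q_comp ::
  "('o, 'a) exact_cat \<Rightarrow> ('o \<times> 'a \<times> 'a) set \<Rightarrow> ('o \<times> 'a \<times> 'a) set \<Rightarrow> ('o \<times> 'a \<times> 'a) set" where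
  "q_comp E B A = {(P, ecomp E p a, ecomp E j b) | P p a j b Z i Z' p'.
    (Z, p, i) \<in> A \<and> (Z', p', j) \<in> B \<and> is_pullback E Z Z' i p' P a b}"

definition q_cat :: "('o, 'a) exact_cat \<Rightarrow> ('o, ('o \<times> 'a \<times> 'a) set) small_cat" where
  "q_cat E = \<lparr>
    cob = eob E,
    chom = (\<lambda>X Y. q_class E X Y ` q_spans E X Y),
    ccomp = q_comp E,
    cid = (\<lambda>X. q_class E X X (X, eid E X, eid E X))\<rparr>"

text \<open>The effect of an exact functor, acting by \<open>Fo\<close> on objects and \<open>Fa\<close> on morphisms, on
  a morphism \<open>A\<close> from \<open>X\<close> to \<open>Y\<close> in the Q-construction.\<close>

definition q_map ::
  "('p, 'b) exact_cat \<Rightarrow> ('o \<Rightarrow> 'p) \<Rightarrow> ('a \<Rightarrow> 'b) \<Rightarrow> 'o \<Rightarrow> 'o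
    \<Rightarrow> ('o \<times> 'a \<times> 'a) set \<Rightarrow> ('p \<times> 'b \<times> 'b) set" where
  "q_map E' Fo Fa X Y A = (\<Union>(Z, p, i)\<in>A. q_class E' (Fo X) (Fo Y) (Fo Z, Fa p, Fa i))"

section \<open>Classifying spaces\<close>

definition index_pairs :: "nat \<Rightarrow> (nat \<times> nat) set" where
  "index_pairs n = {(i, j). i \<le> j \<and> j \<le> n}"

text \<open>An \<open>n\<close>-simplex of the nerve is a functor \<open>(x, f)\<close> from the ordinal \<open>{0 \<le> \<dots> \<le> n}\<close>,
  with \<open>f (i, j) : x i \<rightarrow> x j\<close>.\<close>

type_synonym ('o, 'a) simplex = "(nat \<Rightarrow> 'o) \<times> (nat \<times> nat \<Rightarrow> 'a)"

definition nerve :: "('o, 'a) small_cat \<Rightarrow> nat \<Rightarrow> ('o, 'a) simplex set" where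
  "nerve C n = {(x, f). x \<in> extensional {..n} \<and> f \<in> extensional (index_pairs n) \<and>
    (\<forall>i\<le>n. x i \<in> cob C \<and> f (i, i) = cid C (x i)) \<and>
    (\<forall>(i, j)\<in>index_pairs n. f (i, j) \<in> chom C (x i) (x j)) \<and>
    (\<forall>i j k. i \<le> j \<and> j \<le> k \<and> k \<le> n \<longrightarrow> f (i, k) = ccomp C (f (j, k)) (f (i, j)))}"

definition nerve_act :: "nat \<Rightarrow> (nat \<Rightarrow> nat) \<Rightarrow> ('o, 'a) simplex \<Rightarrow> ('o, 'a) simplex" where
  "nerve_act k \<theta> s = (case s of (x, f) \<Rightarrow>
    (restrict (\<lambda>i. x (\<theta> i)) {..k}, restrict (\<lambda>(i, j). f (\<theta> i, \<theta> j)) (index_pairs k)))"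

definition simplex_push :: "nat \<Rightarrow> (nat \<Rightarrow> nat) \<Rightarrow> (nat \<Rightarrow> real) \<Rightarrow> nat \<Rightarrow> real" where
  "simplex_push k \<theta> t = (\<lambda>j. \<Sum>i | i \<le> k \<and> \<theta> i = j. t i)"

text \<open>The geometric realization of the nerve: the disjoint union of one standard simplex for
  each simplex of the nerve, modulo the equivalence relation generated by
  \<open>(\<theta>\<^sup>* s, t) \<sim> (s, \<theta>\<^sub>* t)\<close>, with the quotient topology.\<close>

type_synonym ('o, 'a) cell_point = "(nat \<times> ('o, 'a) simplex) \<times> (nat \<Rightarrow> real)"

definition cell_space :: "('o, 'a) small_cat \<Rightarrow> ('o, 'a) cell_point topology" where
  "cell_space C = sum_topology
    (\<lambda>(n, s). subtopology (powertop_real UNIV) (standard_simplex n)) (SIGMA n:UNIV. nerve C n)"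

definition cell_glue :: "('o, 'a) small_cat \<Rightarrow> ('o, 'a) cell_point rel" where
  "cell_glue C = {(((k, nerve_act k \<theta> s), t), ((n, s), simplex_push k \<theta> t)) | k n \<theta> s t.
    s \<in> nerve C n \<and> \<theta> \<in> {..k} \<rightarrow> {..n} \<and> mono_on {..k} \<theta> \<and> t \<in> standard_simplex k}"

definition cell_equiv :: "('o, 'a) small_cat \<Rightarrow> ('o, 'a) cell_point rel" where
  "cell_equiv C = (cell_glue C \<union> (cell_glue C)\<inverse>)\<^sup>*"

definition quotient_topology :: "'a topology \<Rightarrow> 'a rel \<Rightarrow> 'a set topology" where
  "quotient_topology X r = topology (\<lambda>U. U \<subseteq> topspace X // r \<and> openin X (\<Union>U))"

lemma istopology_quotient_topology:
  assumes "\<And>c d. c \<in> topspace X // r \<Longrightarrow> d \<in> topspace X // r \<Longrightarrow> c \<noteq> d \<Longrightarrow> c \<inter> d = {}"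
  shows "istopology (\<lambda>U. U \<subseteq> topspace X // r \<and> openin X (\<Union>U))"
proof -
  have *: "\<Union>(S \<inter> T) = \<Union>S \<inter> \<Union>T" if "S \<subseteq> topspace X // r" "T \<subseteq> topspace X // r" for S T
    using that assms by blast
  show ?thesis
    unfolding istopology_def
  proof (intro conjI allI impI; (elim conjE)?)
    fix S T
    assume "S \<subseteq> topspace X // r" "openin X (\<Union>S)" "T \<subseteq> topspace X // r" "openin X (\<Union>T)"
    then show "S \<inter> T \<subseteq> topspace X // r" "openin X (\<Union>(S \<inter> T))"
      by (auto simp: *)
  next
    fix K assume K: "\<forall>S\<in>K. S \<subseteq> topspace X // r \<and> openin X (\<Union>S)"
    then show "\<Union>K \<subseteq> topspace X // r" by blast
    have "\<Union>(\<Union>K) = \<Union>((\<lambda>S. \<Union>S) ` K)" by blast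
    then show "openin X (\<Union>(\<Union>K))" using K by auto
  qed
qed

definition classifying_space :: "('o, 'a) small_cat \<Rightarrow> ('o, 'a) cell_point set topology" where
  "classifying_space C = quotient_topology (cell_space C) (cell_equiv C)"

text \<open>The point given by an object, viewed as a vertex of the nerve.\<close>

definition vertex_point :: "('o, 'a) small_cat \<Rightarrow> 'o \<Rightarrow> ('o, 'a) cell_point set" where
  "vertex_point C X = cell_equiv C ``
    {((0, (restrict (\<lambda>_. X) {..0}, restrict (\<lambda>_. cid C X) (index_pairs 0))),
      (\<lambda>i. if i = 0 then 1 else 0))}"

definition classifying_map ::
  "('p, 'b) small_cat \<Rightarrow> ('o \<Rightarrow> 'p) \<Rightarrow> ('o \<Rightarrow> 'o \<Rightarrow> 'a \<Rightarrow> 'b)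
    \<Rightarrow> ('o, 'a) cell_point set \<Rightarrow> ('p, 'b) cell_point set" where
  "classifying_map D Fo Fa c = cell_equiv D ``
    ((\<lambda>((n, (x, f)), t).
      ((n, (restrict (\<lambda>i. Fo (x i)) {..n},
            restrict (\<lambda>(i, j). Fa (x i) (x j) (f (i, j))) (index_pairs n))), t)) ` c)"

section \<open>Homotopy fibres and homotopy groups\<close>

definition compact_open_space :: "'a topology \<Rightarrow> 'b topology \<Rightarrow> ('a \<Rightarrow> 'b) topology" where
  "compact_open_space X Y = subtopology
    (topology_generated_by {{g. g ` K \<subseteq> U} | K U. compactin X K \<and> openin Y U})
    {g \<in> extensional (topspace X). continuous_map X Y g}"

abbreviation unit_interval :: "real topology" where
  "unit_interval \<equiv> top_of_set {0..1}"

definition homotopy_fibre ::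
  "'x topology \<Rightarrow> 'y topology \<Rightarrow> ('x \<Rightarrow> 'y) \<Rightarrow> 'y \<Rightarrow> ('x \<times> (real \<Rightarrow> 'y)) topology" where
  "homotopy_fibre X Y f y0 = subtopology
    (prod_topology X (compact_open_space unit_interval Y))
    {(x, \<gamma>). \<gamma> 0 = f x \<and> \<gamma> 1 = y0}"

definition cube :: "nat \<Rightarrow> (nat \<Rightarrow> real) topology" where
  "cube n = product_topology (\<lambda>_. unit_interval) {..<n}"

definition cube_boundary :: "nat \<Rightarrow> (nat \<Rightarrow> real) set" where
  "cube_boundary n = {s \<in> topspace (cube n). \<exists>i<n. s i = 0 \<or> s i = 1}"

definition rel_boundary :: "nat \<Rightarrow> 'a \<Rightarrow> ((nat \<Rightarrow> real) \<Rightarrow> 'a) \<Rightarrow> bool" where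
  "rel_boundary n x0 g \<longleftrightarrow> (\<forall>s\<in>cube_boundary n. g s = x0)"

definition sphere_class ::
  "nat \<Rightarrow> 'a topology \<Rightarrow> 'a \<Rightarrow> ((nat \<Rightarrow> real) \<Rightarrow> 'a) \<Rightarrow> ((nat \<Rightarrow> real) \<Rightarrow> 'a) set" where
  "sphere_class n X x0 g = {h. homotopic_with (rel_boundary n x0) (cube n) X g h}"

definition cube_concat ::
  "((nat \<Rightarrow> real) \<Rightarrow> 'a) \<Rightarrow> ((nat \<Rightarrow> real) \<Rightarrow> 'a) \<Rightarrow> (nat \<Rightarrow> real) \<Rightarrow> 'a" where
  "cube_concat g h = (\<lambda>s. if s 0 \<le> 1/2 then g (s(0 := 2 * s 0)) else h (s(0 := 2 * s 0 - 1)))"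

text \<open>The group \<open>\<pi>\<^sub>n(X, x\<^sub>0)\<close> for \<open>n \<ge> 1\<close>.\<close>

definition homotopy_group ::
  "nat \<Rightarrow> 'a topology \<Rightarrow> 'a \<Rightarrow> ((nat \<Rightarrow> real) \<Rightarrow> 'a) set monoid" where
  "homotopy_group n X x0 = \<lparr>
    carrier = sphere_class n X x0 ` {g. continuous_map (cube n) X g \<and> rel_boundary n x0 g},
    monoid.mult = (\<lambda>A B. \<Union>g\<in>A. \<Union>h\<in>B. sphere_class n X x0 (cube_concat g h)),
    one = sphere_class n X x0 (\<lambda>_. x0)\<rparr>"

section \<open>The relative K-theory groups\<close>

text \<open>For an exact category \<open>E\<close>, the space \<open>B Q E\<close> is the zeroth space of the suspension of
  the connective spectrum \<open>K(E)\<close>, naturally in \<open>E\<close>. Hence the \<open>n\<close>-th homotopy group, \<open>n \<ge> 0\<close>,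
  of the homotopy fibre of a map \<open>K(E) \<rightarrow> K(E')\<close> of spectra is the \<open>(n+1)\<close>-st homotopy group
  of the homotopy fibre of \<open>B Q E \<rightarrow> B Q E'\<close>. The forgetful functor is \<open>fst\<close> on objects
  and the identity on the matrices representing morphisms.\<close>

definition relK_group where
  "relK_group (_ :: 'k::{field,finite} itself) m n =
    (let M = (slot_cat m :: ('k slot_data, 'k mat) exact_cat);
         V = (vect_cat :: (nat, 'k mat) exact_cat);
         v0 = vertex_point (q_cat V) (ezero V)
     in homotopy_group (Suc n)
          (homotopy_fibre (classifying_space (q_cat M)) (classifying_space (q_cat V))
            (classifying_map (q_cat V) fst (q_map V fst (\<lambda>F. F))) v0)
          (vertex_point (q_cat M) (ezero M), restrict (\<lambda>_. v0) {0..1}))"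

section \<open>The summands of the homotopy groups\<close>

definition coeff_index :: "nat \<Rightarrow> nat" where
  "coeff_index n = (if odd n then (n + 1) div 2 else n div 2 + 1)"

definition additional_term :: "nat \<Rightarrow> nat \<Rightarrow> nat \<Rightarrow> int monoid" where
  "additional_term m q n = integer_mod_group (gcd m (q ^ coeff_index n - 1))"

text \<open>The other summand: \<open>\<int>\<^sup>m\<^sup>-\<^sup>1\<close> in degree \<open>0\<close>, \<open>(\<int>/(q\<^sup>j - 1))\<^sup>m\<^sup>-\<^sup>1\<close> in degree \<open>2j - 1\<close>,
  and zero in positive even degrees.\<close>

definition principal_term :: "nat \<Rightarrow> nat \<Rightarrow> nat \<Rightarrow> (nat \<Rightarrow> int) monoid" where
  "principal_term m q n =
    (if n = 0 then product_group {..<m - 1} (\<lambda>_. integer_group)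
     else if odd n then product_group {..<m - 1} (\<lambda>_. integer_mod_group (q ^ coeff_index n - 1))
     else singleton_group (\<lambda>_. 0))"

text \<open>Given an isomorphism \<open>\<phi>\<close> of \<open>G\<close> with a direct product, the subgroup of \<open>G\<close>
  corresponding to the second factor.\<close>

definition second_summand ::
  "('g, 'x) monoid_scheme \<Rightarrow> ('a, 'y) monoid_scheme \<Rightarrow> ('g \<Rightarrow> 'a \<times> 'b) \<Rightarrow> ('g, 'x) monoid_scheme" where
  "second_summand G P \<phi> = G\<lparr>carrier := {x \<in> carrier G. fst (\<phi> x) = \<one>\<^bsub>P\<^esub>}\<rparr>"

definition primary_part :: "nat \<Rightarrow> ('g, 'x) monoid_scheme \<Rightarrow> 'g set" where
  "primary_part l G = {x \<in> carrier G. \<exists>k::nat. x [^]\<^bsub>G\<^esub> (l ^ k) = \<one>\<^bsub>G\<^esub>}"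

end

theory Submission
  imports Defs
begin

text \<open>
  The additional term in degree \<open>n\<close> is \<open>\<int>/g\<close> with \<open>g = gcd m (q\<^sup>r - 1)\<close> and \<open>r \<ge> 1\<close>. The
  \<open>l\<close>-primary part of a finite cyclic group of order \<open>g\<close> has \<open>l\<^sup>v\<close> elements, where \<open>v\<close> is the
  multiplicity of \<open>l\<close> in \<open>g\<close>; the multiplicity in a greatest common divisor is the minimum of the
  two multiplicities. Since \<open>l\<close> divides \<open>m\<close>, that number is nontrivial exactly when \<open>l\<close> divides
  \<open>q\<^sup>r - 1\<close>, which never happens if \<open>l\<close> divides \<open>q\<close>, and otherwise means that the order of \<open>q\<close>
  modulo \<open>l\<close> divides \<open>r\<close>. All these conditions are invariant under isomorphism of groups
  (\<open>coefficient_term_pattern\<close>), so they hold for every family of groups isomorphic to the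
  additional terms.

  To pass to the summand inside the relative K-groups, one has to know that these homotopy sets
  are groups and that the given bijections are isomorphisms of groups. Associativity and inverses
  can be transported back along a multiplicative bijection onto a group
  (\<open>group_if_iso_to_group\<close>), so what must be supplied by topology is only that concatenation is
  well defined on homotopy classes and that the class of the constant map is an idempotent. That
  the base point lies in the homotopy fibre at all follows from the bijection itself: a space
  without the base point would have an empty set of spheres, which cannot be in bijection
  with a group (\<open>group_homotopy_group_if_iso\<close>). The argument is thus valid for every pointed
  space in place of the homotopy fibre.
\<close>

section \<open>Primary parts of finite cyclic groups\<close>

lemma primary_part_iso:
  assumes "group G" "group H" "f \<in> iso G H"
  shows "bij_betw f (primary_part l G) (primary_part l H)"
proof -
  interpret f: group_hom G H f
    using assms by (simp add: group_hom_def group_hom_axioms_def iso_def)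
  have inj: "inj_on f (carrier G)" and img: "f ` carrier G = carrier H"
    using assms(3) by (auto simp: iso_def bij_betw_def)
  have pow: "f x [^]\<^bsub>H\<^esub> n = \<one>\<^bsub>H\<^esub> \<longleftrightarrow> x [^]\<^bsub>G\<^esub> n = \<one>\<^bsub>G\<^esub>" if "x \<in> carrier G" for x and n :: nat
    using that inj_onD[OF inj, of "x [^]\<^bsub>G\<^esub> n" "\<one>\<^bsub>G\<^esub>"]
    by (auto simp flip: f.hom_nat_pow)
  have "f ` primary_part l G = primary_part l H"
    unfolding primary_part_def img[symmetric] using pow by auto
  moreover have "inj_on f (primary_part l G)"
    using inj by (rule inj_on_subset) (auto simp: primary_part_def)
  ultimately show ?thesis
    by (simp add: bij_betw_def)
qed

text \<open>Write \<open>g = l\<^sup>v c\<close> with \<open>c\<close> prime to \<open>l\<close>. An element \<open>x\<close> is killed by some power of \<open>l\<close>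
  exactly if \<open>c\<close> divides \<open>x\<close>, because \<open>c\<close> is coprime to all powers of \<open>l\<close>.\<close>

lemma primary_part_integer_mod_group:
  fixes l g :: nat
  assumes "prime l" "g > 0"
  shows "primary_part l (integer_mod_group g)
    = (\<lambda>i. int (g div l ^ multiplicity l g) * int i) ` {..<l ^ multiplicity l g}"
proof -
  define v where "v = multiplicity l g"
  obtain c where g: "g = l ^ v * c" and c: "\<not> l dvd c"
    using multiplicity_decompose'[of g l] assms unfolding v_def
    by (metis gr_implies_not0 not_prime_unit)
  have l: "l > 0" and c0: "c > 0"
    using assms g by (auto simp: prime_gt_0_nat intro!: Nat.gr0I)
  have cop: "coprime (int c) (int l ^ k)" for k
    using prime_imp_coprime[OF assms(1) c] by (simp add: coprime_commute)
  have "x \<in> primary_part l (integer_mod_group g) \<longleftrightarrow> x \<in> (\<lambda>i. int c * int i) ` {..<l ^ v}" for x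
  proof
    assume "x \<in> primary_part l (integer_mod_group g)"
    then obtain k where x: "0 \<le> x" "x < int g" and "int g dvd int l ^ k * x"
      using assms by (auto simp: primary_part_def carrier_integer_mod_group mod_0_imp_dvd)
    then have "int c dvd int l ^ k * x"
      unfolding g by (metis dvd_mult_right of_nat_mult)
    then have "int c dvd x"
      using cop coprime_dvd_mult_right_iff by blast
    then obtain y where y: "x = int c * y" ..
    have "y \<ge> 0" using x(1) c0 by (simp add: y zero_le_mult_iff)
    moreover have "y < int (l ^ v)"
      using x(2) c0 unfolding y g by (simp add: mult.commute)
    ultimately have "x = int c * int (nat y)" "nat y < l ^ v"
      by (auto simp: y nat_less_iff)
    then show "x \<in> (\<lambda>i. int c * int i) ` {..<l ^ v}" by blast
  next
    assume "x \<in> (\<lambda>i. int c * int i) ` {..<l ^ v}"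
    then obtain i where i: "i < l ^ v" and x: "x = int (c * i)" by auto
    have "x < int g"
      using i c0 unfolding g x of_nat_less_iff by (simp add: mult.commute)
    moreover have "int g dvd int l ^ v * x"
      unfolding x g by simp
    ultimately show "x \<in> primary_part l (integer_mod_group g)"
      using assms by (auto simp: primary_part_def carrier_integer_mod_group x intro!: exI[of _ v])
  qed
  moreover have "g div l ^ v = c"
    using l by (simp add: g)
  ultimately show ?thesis
    unfolding v_def by blast
qed

lemma card_primary_part_integer_mod_group:
  fixes l g :: nat
  assumes "prime l" "g > 0"
  shows "card (primary_part l (integer_mod_group g)) = l ^ multiplicity l g"
proof -
  have "g div l ^ multiplicity l g \<noteq> 0"
    using assms by (metis dvd_div_eq_0_iff gr_implies_not0 multiplicity_dvd)
  then show ?thesis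
    unfolding primary_part_integer_mod_group[OF assms]
    by (subst card_image) (auto simp: inj_on_def)
qed

lemma card_primary_part_cyclic:
  fixes l g :: nat
  assumes "prime l" "g > 0" "group A" "A \<cong> integer_mod_group g"
  shows "card (primary_part l A) = l ^ multiplicity l g"
proof -
  obtain f where "f \<in> iso A (integer_mod_group g)"
    using assms(4) by (auto simp: is_iso_def)
  then show ?thesis
    using primary_part_iso[OF assms(3) group_integer_mod_group] bij_betw_same_card
      card_primary_part_integer_mod_group[OF assms(1,2)] by metis
qed

lemma primary_part_cyclic_trivial_iff:
  fixes l g :: nat
  assumes "prime l" "g > 0" "group A" "A \<cong> integer_mod_group g"
  shows "primary_part l A = {\<one>\<^bsub>A\<^esub>} \<longleftrightarrow> \<not> l dvd g"
proof -
  interpret A: group A by fact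
  \<comment> \<open>The unit belongs to the primary part, so triviality can be read off from the cardinality.\<close>
  have "\<one>\<^bsub>A\<^esub> \<in> primary_part l A"
    by (simp add: primary_part_def)
  then have "primary_part l A = {\<one>\<^bsub>A\<^esub>} \<longleftrightarrow> card (primary_part l A) = 1"
    by (auto simp: card_1_singleton_iff)
  also have "\<dots> \<longleftrightarrow> multiplicity l g = 0"
    using prime_gt_1_nat[OF assms(1)]
    by (metis card_primary_part_cyclic[OF assms] less_irrefl one_less_power not_gr_zero power_0)
  also have "\<dots> \<longleftrightarrow> \<not> l dvd g"
    using assms(1,2) by (metis gr_implies_not0 multiplicity_eq_zero_iff not_prime_unit)
  finally show ?thesis .
qed

lemma carrier_cyclic_trivial_iff:
  assumes "g > 0" "group A" "A \<cong> integer_mod_group g"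
  shows "carrier A = {\<one>\<^bsub>A\<^esub>} \<longleftrightarrow> g = 1"
proof -
  interpret A: group A by fact
  have "card (carrier A) = g"
    using iso_same_card[OF assms(3)] assms(1) by (simp add: carrier_integer_mod_group)
  then show ?thesis
    using A.one_closed by (metis One_nat_def card_1_singleton_iff singletonD)
qed

section \<open>The coefficient terms\<close>

lemma coeff_index_simps:
  "j \<ge> 1 \<Longrightarrow> coeff_index (2 * j - 1) = j" "coeff_index (2 * j) = j + 1" "coeff_index n \<ge> 1"
  by (simp_all add: coeff_index_def)

lemma prime_dvd_gcd_power_minus_1_iff:
  fixes l m q r :: nat
  assumes "prime l" "l dvd m" "q > 0" "r \<ge> 1"
  shows "l dvd gcd m (q ^ r - 1) \<longleftrightarrow> \<not> l dvd q \<and> ord l q dvd r"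
proof -
  have "l dvd gcd m (q ^ r - 1) \<longleftrightarrow> [q ^ r = 1] (mod l)"
    using assms(2,3) cong_altdef_nat[of 1 "q ^ r" l] by simp
  moreover have "\<not> l dvd q" if "[q ^ r = 1] (mod l)"
  proof
    assume "l dvd q"
    then have "l dvd q ^ r"
      by (rule dvd_trans[OF _ dvd_power]) (use assms(4) in simp)
    then have "l dvd 1"
      using cong_dvd_iff[OF that] by blast
    then show False
      using assms(1) not_prime_unit by blast
  qed
  ultimately show ?thesis
    unfolding ord_divides by blast
qed

text \<open>The terms enter only up to isomorphism, so that the conclusion covers the cyclic groups
  themselves as well as their copies inside other groups.\<close>

lemma coefficient_term_pattern:
  fixes m l q :: nat
  assumes "m \<ge> 2" "prime l" "l dvd m" "q \<ge> 2"
    and grp: "\<And>n. group (A n)" and iso: "\<And>n. A n \<cong> additional_term m q n"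
  shows
    "(l dvd q \<longrightarrow> (\<forall>n. primary_part l (A n) = {\<one>\<^bsub>A n\<^esub>})) \<and>
        (\<not> l dvd q \<longrightarrow>
          (\<forall>j\<ge>1. primary_part l (A (2 * j - 1)) \<noteq> {\<one>\<^bsub>A (2 * j - 1)\<^esub>} \<longleftrightarrow> ord l q dvd j) \<and>
          (\<forall>j. primary_part l (A (2 * j)) \<noteq> {\<one>\<^bsub>A (2 * j)\<^esub>} \<longleftrightarrow> ord l q dvd j + 1) \<and>
          (\<forall>j\<ge>1. primary_part l (A (2 * j - 1)) \<noteq> {\<one>\<^bsub>A (2 * j - 1)\<^esub>} \<longrightarrow>
            card (primary_part l (A (2 * j - 1)))
              = l ^ min (multiplicity l m) (multiplicity l (q ^ j - 1))) \<and>
          (\<forall>j. primary_part l (A (2 * j)) \<noteq> {\<one>\<^bsub>A (2 * j)\<^esub>} \<longrightarrow>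
            card (primary_part l (A (2 * j)))
              = l ^ min (multiplicity l m) (multiplicity l (q ^ (j + 1) - 1)))) \<and>
        (\<forall>j\<ge>1. carrier (A (2 * j - 1)) \<noteq> {\<one>\<^bsub>A (2 * j - 1)\<^esub>} \<longleftrightarrow> gcd m (q ^ j - 1) > 1) \<and>
        (\<forall>j. carrier (A (2 * j)) \<noteq> {\<one>\<^bsub>A (2 * j)\<^esub>} \<longleftrightarrow> gcd m (q ^ (j + 1) - 1) > 1)"
proof -
  define g where "g n = gcd m (q ^ coeff_index n - 1)" for n
  have g0: "g n > 0" for n
    using assms(1) by (simp add: g_def)
  have q0: "q > 0"
    using assms(4) by simp
  have cyc: "A n \<cong> integer_mod_group (g n)" for n
    using iso[of n] by (simp add: additional_term_def g_def)
  have triv: "primary_part l (A n) = {\<one>\<^bsub>A n\<^esub>} \<longleftrightarrow> \<not> (\<not> l dvd q \<and> ord l q dvd coeff_index n)" for n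
    using primary_part_cyclic_trivial_iff[OF assms(2) g0 grp cyc, of n]
      prime_dvd_gcd_power_minus_1_iff[OF assms(2,3) q0 coeff_index_simps(3), of n]
    by (simp only: g_def)
  have card: "card (primary_part l (A n))
      = l ^ min (multiplicity l m) (multiplicity l (q ^ coeff_index n - 1))" for n
  proof -
    have "q ^ coeff_index n > 1"
      using assms(4) coeff_index_simps(3)[of n] by (intro one_less_power) auto
    then have "multiplicity l (g n) = min (multiplicity l m) (multiplicity l (q ^ coeff_index n - 1))"
      unfolding g_def using assms(1,2) by (intro multiplicity_gcd) auto
    then show ?thesis
      by (simp only: card_primary_part_cyclic[OF assms(2) g0 grp cyc])
  qed
  have carr: "carrier (A n) \<noteq> {\<one>\<^bsub>A n\<^esub>} \<longleftrightarrow> g n > 1" for n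
    using carrier_cyclic_trivial_iff[OF g0 grp cyc, of n] g0[of n]
    by (cases "g n = 1") simp_all
  have odd: "primary_part l (A (2 * j - 1)) \<noteq> {\<one>\<^bsub>A (2 * j - 1)\<^esub>} \<longleftrightarrow> \<not> l dvd q \<and> ord l q dvd j"
      "card (primary_part l (A (2 * j - 1)))
        = l ^ min (multiplicity l m) (multiplicity l (q ^ j - 1))"
      "carrier (A (2 * j - 1)) \<noteq> {\<one>\<^bsub>A (2 * j - 1)\<^esub>} \<longleftrightarrow> gcd m (q ^ j - 1) > 1"
    if "j \<ge> 1" for j
    unfolding triv card carr g_def coeff_index_simps(1)[OF that] by (rule not_not refl)+
  have even: "primary_part l (A (2 * j)) \<noteq> {\<one>\<^bsub>A (2 * j)\<^esub>} \<longleftrightarrow> \<not> l dvd q \<and> ord l q dvd j + 1"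
      "card (primary_part l (A (2 * j)))
        = l ^ min (multiplicity l m) (multiplicity l (q ^ (j + 1) - 1))"
      "carrier (A (2 * j)) \<noteq> {\<one>\<^bsub>A (2 * j)\<^esub>} \<longleftrightarrow> gcd m (q ^ (j + 1) - 1) > 1"
    for j
    unfolding triv card carr g_def coeff_index_simps(2) by (rule not_not refl)+
  show ?thesis
  proof (intro conjI impI allI)
    show "primary_part l (A n) = {\<one>\<^bsub>A n\<^esub>}" if "l dvd q" for n
      unfolding triv using that by simp
  qed (simp_all only: odd even simp_thms)
qed

section \<open>Transport of group structure along multiplicative bijections\<close>

text \<open>Membership of a map in \<open>iso G H\<close> says nothing about closure of \<open>G\<close> or about its unit, so
  these have to be given. An idempotent suffices as unit, because its image is an idempotent of a
  group, hence the neutral element.\<close>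

lemma group_if_iso_to_group:
  assumes "group H" and iso: "f \<in> iso G H"
    and closed: "\<And>x y. x \<in> carrier G \<Longrightarrow> y \<in> carrier G \<Longrightarrow> x \<otimes>\<^bsub>G\<^esub> y \<in> carrier G"
    and one: "\<one>\<^bsub>G\<^esub> \<in> carrier G" "\<one>\<^bsub>G\<^esub> \<otimes>\<^bsub>G\<^esub> \<one>\<^bsub>G\<^esub> = \<one>\<^bsub>G\<^esub>"
  shows "group G"
proof -
  interpret H: group H by fact
  have inj: "inj_on f (carrier G)" and img: "f ` carrier G = carrier H"
    using iso by (auto simp: iso_def bij_betw_def)
  have mult: "f (x \<otimes>\<^bsub>G\<^esub> y) = f x \<otimes>\<^bsub>H\<^esub> f y" if "x \<in> carrier G" "y \<in> carrier G" for x y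
    using iso that by (auto simp: iso_def hom_def)
  have fc: "f x \<in> carrier H" if "x \<in> carrier G" for x
    using img that by blast
  have f1: "f \<one>\<^bsub>G\<^esub> = \<one>\<^bsub>H\<^esub>"
    using mult[OF one(1) one(1)] one fc[OF one(1)] by simp
  show ?thesis
  proof (rule groupI)
    fix x assume x: "x \<in> carrier G"
    then obtain y where y: "y \<in> carrier G" "f y = inv\<^bsub>H\<^esub> f x"
      using img fc by (metis H.inv_closed imageE)
    then have "f (y \<otimes>\<^bsub>G\<^esub> x) = f \<one>\<^bsub>G\<^esub>"
      using x fc by (simp add: mult f1)
    then show "\<exists>y\<in>carrier G. y \<otimes>\<^bsub>G\<^esub> x = \<one>\<^bsub>G\<^esub>"
      using inj x y(1) closed one(1) by (meson inj_onD)
    show "\<one>\<^bsub>G\<^esub> \<otimes>\<^bsub>G\<^esub> x = x"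
      using x one(1) closed by (intro inj_onD[OF inj]) (auto simp: mult f1 fc)
  next
    fix x y z assume "x \<in> carrier G" "y \<in> carrier G" "z \<in> carrier G"
    then show "x \<otimes>\<^bsub>G\<^esub> y \<otimes>\<^bsub>G\<^esub> z = x \<otimes>\<^bsub>G\<^esub> (y \<otimes>\<^bsub>G\<^esub> z)"
      using closed by (intro inj_onD[OF inj]) (auto simp: mult fc H.m_assoc)
  qed (use closed one in auto)
qed

text \<open>The second summand is the kernel of the first component of \<open>\<phi>\<close>, and the second component
  of \<open>\<phi>\<close> maps that kernel bijectively to \<open>B\<close>.\<close>

lemma second_summand_iso:
  assumes G: "group G" and P: "group P" and B: "group B" and \<phi>: "\<phi> \<in> iso G (P \<times>\<times> B)"
  shows "group (second_summand G P \<phi>)" "second_summand G P \<phi> \<cong> B"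
proof -
  interpret P: group P by fact
  have inj: "inj_on \<phi> (carrier G)" and img: "\<phi> ` carrier G = carrier P \<times> carrier B"
    using \<phi> by (auto simp: iso_def bij_betw_def)
  have hom: "\<phi> \<in> hom G (P \<times>\<times> B)"
    using \<phi> by (simp add: iso_def)
  have "fst \<circ> \<phi> \<in> hom G P"
    using hom by (auto simp: hom_def DirProd_def Pi_iff mem_Times_iff split_beta)
  then interpret k: group_hom G P "fst \<circ> \<phi>"
    using G P by (simp add: group_hom_def group_hom_axioms_def)
  have "second_summand G P \<phi> = G\<lparr>carrier := kernel G P (fst \<circ> \<phi>)\<rparr>"
    by (simp add: second_summand_def kernel_def)
  then show "group (second_summand G P \<phi>)"
    using k.subgroup_kernel group.subgroup_imp_group[OF G] by simp
  have "bij_betw (snd \<circ> \<phi>) (carrier (second_summand G P \<phi>)) (carrier B)"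
    unfolding bij_betw_def
  proof
    show "inj_on (snd \<circ> \<phi>) (carrier (second_summand G P \<phi>))"
      using inj by (auto simp: inj_on_def second_summand_def prod_eq_iff)
    have "b \<in> (snd \<circ> \<phi>) ` carrier (second_summand G P \<phi>)" if "b \<in> carrier B" for b
    proof -
      have "(\<one>\<^bsub>P\<^esub>, b) \<in> \<phi> ` carrier G"
        unfolding img using that by simp
      then obtain x where "x \<in> carrier G" "\<phi> x = (\<one>\<^bsub>P\<^esub>, b)" by (metis imageE)
      then show ?thesis
        by (auto simp: second_summand_def intro!: image_eqI[of _ _ x])
    qed
    moreover have "snd (\<phi> x) \<in> carrier B" if "x \<in> carrier G" for x
      using img that by (metis imageI mem_Times_iff)
    ultimately show "(snd \<circ> \<phi>) ` carrier (second_summand G P \<phi>) = carrier B"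
      by (auto simp: second_summand_def)
  qed
  moreover have "snd \<circ> \<phi> \<in> hom (second_summand G P \<phi>) B"
    using hom by (auto simp: hom_def second_summand_def DirProd_def Pi_iff mem_Times_iff split_beta)
  ultimately show "second_summand G P \<phi> \<cong> B"
    by (auto simp: is_iso_def iso_def)
qed

section \<open>Concatenation of spheres\<close>

lemma topspace_cube: "topspace (cube n) = {..<n} \<rightarrow>\<^sub>E {0..1}"
  by (simp add: cube_def)

lemma fun_upd_in_cube:
  assumes "s \<in> topspace (cube n)" "n > 0" "0 \<le> c" "c \<le> 1"
  shows "s(0 := c) \<in> topspace (cube n)"
  using assms by (auto simp: topspace_cube PiE_iff extensional_def)

lemma rel_boundary_cube_concat:
  assumes "n > 0" and g: "rel_boundary n x0 g" and h: "rel_boundary n x0 h"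
  shows "rel_boundary n x0 (cube_concat g h)"
  unfolding rel_boundary_def
proof
  fix s assume "s \<in> cube_boundary n"
  then obtain i where s: "s \<in> topspace (cube n)" and i: "i < n" "s i = 0 \<or> s i = 1"
    by (auto simp: cube_boundary_def)
  have s0: "0 \<le> s 0" "s 0 \<le> 1"
    using s assms(1) by (auto simp: topspace_cube PiE_iff)
  show "cube_concat g h s = x0"
  proof (cases "s 0 \<le> 1/2")
    case True
    then have "s(0 := 2 * s 0) \<in> cube_boundary n"
      using fun_upd_in_cube[OF s assms(1)] s0 i
      by (auto simp: cube_boundary_def intro!: exI[of _ i])
    then show ?thesis
      using g True by (simp add: cube_concat_def rel_boundary_def)
  next
    case False
    then have "s(0 := 2 * s 0 - 1) \<in> cube_boundary n"
      using fun_upd_in_cube[OF s assms(1)] s0 i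
      by (auto simp: cube_boundary_def intro!: exI[of _ i])
    then show ?thesis
      using h False by (simp add: cube_concat_def rel_boundary_def)
  qed
qed

lemma continuous_map_cube_coord:
  assumes "i < n"
  shows "continuous_map (cube n) euclideanreal (\<lambda>s. s i)"
  using continuous_map_product_projection[of i "{..<n}" "\<lambda>_. unit_interval"] assms
  by (simp add: cube_def continuous_map_in_subtopology)

lemma continuous_map_rescale_first:
  assumes "n > 0" "continuous_map Z euclideanreal c" "c ` topspace Z \<subseteq> {0..1}"
    and p: "continuous_map Z (cube n) p"
  shows "continuous_map Z (cube n) (\<lambda>z. (p z)(0 := c z))"
  unfolding cube_def continuous_map_componentwise
proof (intro conjI ballI)
  have "p z \<in> topspace (cube n)" if "z \<in> topspace Z" for z
    using p that by (auto simp: continuous_map_def)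
  then show "(\<lambda>z. (p z)(0 := c z)) ` topspace Z \<subseteq> extensional {..<n}"
    using assms(1) by (force simp: topspace_cube PiE_iff extensional_def)
next
  fix i assume "i \<in> {..<n}"
  then have "continuous_map Z unit_interval (\<lambda>z. p z i)"
    using p by (auto simp: cube_def continuous_map_componentwise)
  then show "continuous_map Z unit_interval (\<lambda>z. ((p z)(0 := c z)) i)"
    using assms(2,3) by (cases "i = 0") (auto simp: continuous_map_in_subtopology)
qed

text \<open>Both halves of the concatenated homotopy take the value \<open>x0\<close> where they meet, because there
  the rescaled first coordinate is \<open>1\<close> respectively \<open>0\<close>.\<close>

lemma homotopic_cube_concat:
  assumes "n > 0"
    and g: "homotopic_with (rel_boundary n x0) (cube n) X g g'"
    and h: "homotopic_with (rel_boundary n x0) (cube n) X h h'"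
  shows "homotopic_with (rel_boundary n x0) (cube n) X (cube_concat g h) (cube_concat g' h')"
proof -
  obtain G where G: "continuous_map (prod_topology unit_interval (cube n)) X G"
    "\<And>s. G (0, s) = g s" "\<And>s. G (1, s) = g' s"
    "\<And>t. t \<in> {0..1} \<Longrightarrow> rel_boundary n x0 (\<lambda>s. G (t, s))"
    using g unfolding homotopic_with_def by auto
  obtain H where H: "continuous_map (prod_topology unit_interval (cube n)) X H"
    "\<And>s. H (0, s) = h s" "\<And>s. H (1, s) = h' s"
    "\<And>t. t \<in> {0..1} \<Longrightarrow> rel_boundary n x0 (\<lambda>s. H (t, s))"
    using h unfolding homotopic_with_def by auto
  define Z where "Z = prod_topology unit_interval (cube n)"
  have fst: "continuous_map Z unit_interval fst" and snd: "continuous_map Z (cube n) snd"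
    by (simp_all add: Z_def continuous_map_fst continuous_map_snd)
  have c: "continuous_map Z euclideanreal (\<lambda>z. snd z 0)"
    using continuous_map_compose[OF snd continuous_map_cube_coord[OF assms(1)]]
    by (simp add: o_def)
  have range: "0 \<le> snd z 0" "snd z 0 \<le> 1" if "z \<in> topspace Z" for z
  proof -
    have "snd z \<in> topspace (cube n)"
      using that unfolding Z_def topspace_prod_topology by (rule mem_Times_iff[THEN iffD1, THEN conjunct2])
    then have "snd z 0 \<in> {0..1}"
      unfolding topspace_cube using assms(1) by (rule PiE_mem[OF _ lessThan_iff[THEN iffD2]])
    then show "0 \<le> snd z 0" "snd z 0 \<le> 1" by simp_all
  qed
  have "continuous_map Z X (\<lambda>z. if snd z 0 \<le> 1/2 then G (fst z, (snd z)(0 := 2 * snd z 0))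
      else H (fst z, (snd z)(0 := 2 * snd z 0 - 1)))"
  proof (rule continuous_map_cases_le)
    let ?L = "subtopology Z {z \<in> topspace Z. snd z 0 \<le> 1/2}"
    let ?R = "subtopology Z {z \<in> topspace Z. 1/2 \<le> snd z 0}"
    have "continuous_map ?L (cube n) (\<lambda>z. (snd z)(0 := 2 * snd z 0))"
      using range by (intro continuous_map_rescale_first assms(1) continuous_map_real_mult
          continuous_map_from_subtopology[OF c] continuous_map_from_subtopology[OF snd]) auto
    then have "continuous_map ?L (prod_topology unit_interval (cube n))
        (\<lambda>z. (fst z, (snd z)(0 := 2 * snd z 0)))"
      by (intro continuous_map_pairedI continuous_map_from_subtopology[OF fst])
    from continuous_map_compose[OF this G(1)]
    show "continuous_map ?L X (\<lambda>z. G (fst z, (snd z)(0 := 2 * snd z 0)))"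
      by (simp add: o_def)
    have "continuous_map ?R (cube n) (\<lambda>z. (snd z)(0 := 2 * snd z 0 - 1))"
      using range by (intro continuous_map_rescale_first assms(1) continuous_map_real_mult
          continuous_map_diff
          continuous_map_from_subtopology[OF c] continuous_map_from_subtopology[OF snd]) auto
    then have "continuous_map ?R (prod_topology unit_interval (cube n))
        (\<lambda>z. (fst z, (snd z)(0 := 2 * snd z 0 - 1)))"
      by (intro continuous_map_pairedI continuous_map_from_subtopology[OF fst])
    from continuous_map_compose[OF this H(1)]
    show "continuous_map ?R X (\<lambda>z. H (fst z, (snd z)(0 := 2 * snd z 0 - 1)))"
      by (simp add: o_def)
  next
    fix z assume z: "z \<in> topspace Z" "snd z 0 = 1/2"
    then have t: "fst z \<in> {0..1}" and s: "snd z \<in> topspace (cube n)"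
      by (auto simp: Z_def)
    have "(snd z)(0 := c) \<in> cube_boundary n" if "c = 0 \<or> c = 1" for c
      using fun_upd_in_cube[OF s assms(1), of c] that assms(1)
      by (auto simp: cube_boundary_def intro!: exI[of _ "0::nat"])
    then have "G (fst z, (snd z)(0 := 1)) = x0" "H (fst z, (snd z)(0 := 0)) = x0"
      using G(4)[OF t] H(4)[OF t] by (auto simp: rel_boundary_def)
    then show "G (fst z, (snd z)(0 := 2 * snd z 0)) = H (fst z, (snd z)(0 := 2 * snd z 0 - 1))"
      by (simp add: z(2))
  qed (use c in auto)
  then have "continuous_map Z X
      (\<lambda>z. cube_concat (\<lambda>s. G (fst z, s)) (\<lambda>s. H (fst z, s)) (snd z))"
    by (simp add: cube_concat_def)
  moreover have "rel_boundary n x0 (cube_concat (\<lambda>s. G (t, s)) (\<lambda>s. H (t, s)))"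
    if "t \<in> {0..1}" for t
    using that G(4) H(4) by (intro rel_boundary_cube_concat assms(1))
  ultimately show ?thesis
    unfolding homotopic_with_def Z_def
    by (intro exI[of _ "\<lambda>z. cube_concat (\<lambda>s. G (fst z, s)) (\<lambda>s. H (fst z, s)) (snd z)"])
      (simp add: G(2,3) H(2,3))
qed

lemma sphere_class_eq:
  assumes "homotopic_with (rel_boundary n x0) (cube n) X g h"
  shows "sphere_class n X x0 g = sphere_class n X x0 h"
  using assms unfolding sphere_class_def
  by (auto intro: homotopic_with_trans homotopic_with_symD)

text \<open>The product of two classes is a union over all pairs of representatives; since homotopies can
  be concatenated, every pair contributes the same class.\<close>

lemma homotopy_group_mult:
  assumes "n > 0"
    and g: "continuous_map (cube n) X g" "rel_boundary n x0 g"
    and h: "continuous_map (cube n) X h" "rel_boundary n x0 h"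
  shows "sphere_class n X x0 g \<otimes>\<^bsub>homotopy_group n X x0\<^esub> sphere_class n X x0 h
    = sphere_class n X x0 (cube_concat g h)"
proof -
  have "sphere_class n X x0 (cube_concat g' h') = sphere_class n X x0 (cube_concat g h)"
    if "g' \<in> sphere_class n X x0 g" "h' \<in> sphere_class n X x0 h" for g' h'
    using that homotopic_cube_concat[OF assms(1)] sphere_class_eq
    unfolding sphere_class_def mem_Collect_eq by metis
  moreover have "g \<in> sphere_class n X x0 g" "h \<in> sphere_class n X x0 h"
    using g h by (auto simp: sphere_class_def)
  ultimately show ?thesis
    unfolding homotopy_group_def monoid.simps by blast
qed

lemma continuous_map_cube_concat:
  assumes "n > 0"
    and g: "continuous_map (cube n) X g" "rel_boundary n x0 g"
    and h: "continuous_map (cube n) X h" "rel_boundary n x0 h"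
  shows "continuous_map (cube n) X (cube_concat g h)"
proof -
  have "homotopic_with (rel_boundary n x0) (cube n) X (cube_concat g h) (cube_concat g h)"
    using g h by (intro homotopic_cube_concat assms(1)) simp_all
  then show ?thesis by simp
qed

text \<open>The boundary of a cube of positive dimension is nonempty, so a single sphere already shows
  that the base point belongs to the space.\<close>

lemma group_homotopy_group_if_iso:
  assumes "n > 0" "group H" and iso: "f \<in> iso (homotopy_group n X x0) H"
  shows "group (homotopy_group n X x0)"
proof (rule group_if_iso_to_group[OF assms(2) iso])
  let ?S = "{g. continuous_map (cube n) X g \<and> rel_boundary n x0 g}"
  let ?\<pi> = "homotopy_group n X x0"
  have carr: "carrier ?\<pi> = sphere_class n X x0 ` ?S"
    by (simp add: homotopy_group_def)
  have "carrier ?\<pi> \<noteq> {}"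
    using iso monoid.one_closed[OF group.is_monoid[OF assms(2)]]
    by (auto simp: iso_def bij_betw_def)
  then obtain g where g: "continuous_map (cube n) X g" "rel_boundary n x0 g"
    unfolding carr by blast
  have "restrict (\<lambda>_. 0) {..<n} \<in> cube_boundary n"
    using assms(1) by (auto simp: cube_boundary_def topspace_cube)
  then have "x0 \<in> topspace X"
    using g unfolding rel_boundary_def continuous_map_def cube_boundary_def by fastforce
  then have const: "(\<lambda>_. x0) \<in> ?S"
    by (simp add: rel_boundary_def)
  have one: "\<one>\<^bsub>?\<pi>\<^esub> = sphere_class n X x0 (\<lambda>_. x0)"
    by (simp add: homotopy_group_def)
  show "\<one>\<^bsub>?\<pi>\<^esub> \<in> carrier ?\<pi>"
    unfolding carr one using const by blast
  show "\<one>\<^bsub>?\<pi>\<^esub> \<otimes>\<^bsub>?\<pi>\<^esub> \<one>\<^bsub>?\<pi>\<^esub> = \<one>\<^bsub>?\<pi>\<^esub>"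
    unfolding one using const homotopy_group_mult[OF assms(1), of X "\<lambda>_. x0" x0 "\<lambda>_. x0"]
    by (simp add: cube_concat_def)
  fix A B assume "A \<in> carrier ?\<pi>" "B \<in> carrier ?\<pi>"
  then obtain g h where A: "A = sphere_class n X x0 g" "g \<in> ?S"
    and B: "B = sphere_class n X x0 h" "h \<in> ?S"
    unfolding carr by blast
  then have gh: "continuous_map (cube n) X g" "rel_boundary n x0 g"
    "continuous_map (cube n) X h" "rel_boundary n x0 h"
    by simp_all
  have "cube_concat g h \<in> ?S"
    using continuous_map_cube_concat[OF assms(1) gh]
      rel_boundary_cube_concat[OF assms(1) gh(2,4)] by simp
  moreover have "A \<otimes>\<^bsub>?\<pi>\<^esub> B = sphere_class n X x0 (cube_concat g h)"
    using homotopy_group_mult[OF assms(1) gh] by (simp only: A B)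
  ultimately show "A \<otimes>\<^bsub>?\<pi>\<^esub> B \<in> carrier ?\<pi>"
    unfolding carr by (simp only: imageI)
qed

section \<open>The coefficient summands of relative K-theory\<close>

lemma group_principal_term: "group (principal_term m q n)"
  by (simp add: principal_term_def group_integer_group)

lemma group_additional_term: "group (additional_term m q n)"
  by (simp add: additional_term_def)

theorem corollary6p2:
  fixes m l q :: nat
  assumes "m \<ge> 2" and "prime l" and "l dvd m" and "q = CARD('k::{field,finite})"
  shows
    "(let A = additional_term m q in
        (l dvd q \<longrightarrow> (\<forall>n. primary_part l (A n) = {\<one>\<^bsub>A n\<^esub>})) \<and>
        (\<not> l dvd q \<longrightarrow>
          (\<forall>j\<ge>1. primary_part l (A (2 * j - 1)) \<noteq> {\<one>\<^bsub>A (2 * j - 1)\<^esub>} \<longleftrightarrow> ord l q dvd j) \<and>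
          (\<forall>j. primary_part l (A (2 * j)) \<noteq> {\<one>\<^bsub>A (2 * j)\<^esub>} \<longleftrightarrow> ord l q dvd j + 1) \<and>
          (\<forall>j\<ge>1. primary_part l (A (2 * j - 1)) \<noteq> {\<one>\<^bsub>A (2 * j - 1)\<^esub>} \<longrightarrow>
            card (primary_part l (A (2 * j - 1)))
              = l ^ min (multiplicity l m) (multiplicity l (q ^ j - 1))) \<and>
          (\<forall>j. primary_part l (A (2 * j)) \<noteq> {\<one>\<^bsub>A (2 * j)\<^esub>} \<longrightarrow>
            card (primary_part l (A (2 * j)))
              = l ^ min (multiplicity l m) (multiplicity l (q ^ (j + 1) - 1)))) \<and>
        (\<forall>j\<ge>1. carrier (A (2 * j - 1)) \<noteq> {\<one>\<^bsub>A (2 * j - 1)\<^esub>} \<longleftrightarrow> gcd m (q ^ j - 1) > 1) \<and>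
        (\<forall>j. carrier (A (2 * j)) \<noteq> {\<one>\<^bsub>A (2 * j)\<^esub>} \<longleftrightarrow> gcd m (q ^ (j + 1) - 1) > 1)) \<and>
     (\<forall>\<phi>. (\<forall>n. \<phi> n \<in> iso (relK_group TYPE('k) m n)
                        (principal_term m q n \<times>\<times> additional_term m q n)) \<longrightarrow>
      (let A = (\<lambda>n. second_summand (relK_group TYPE('k) m n) (principal_term m q n) (\<phi> n)) in
        (l dvd q \<longrightarrow> (\<forall>n. primary_part l (A n) = {\<one>\<^bsub>A n\<^esub>})) \<and>
        (\<not> l dvd q \<longrightarrow>
          (\<forall>j\<ge>1. primary_part l (A (2 * j - 1)) \<noteq> {\<one>\<^bsub>A (2 * j - 1)\<^esub>} \<longleftrightarrow> ord l q dvd j) \<and>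
          (\<forall>j. primary_part l (A (2 * j)) \<noteq> {\<one>\<^bsub>A (2 * j)\<^esub>} \<longleftrightarrow> ord l q dvd j + 1) \<and>
          (\<forall>j\<ge>1. primary_part l (A (2 * j - 1)) \<noteq> {\<one>\<^bsub>A (2 * j - 1)\<^esub>} \<longrightarrow>
            card (primary_part l (A (2 * j - 1)))
              = l ^ min (multiplicity l m) (multiplicity l (q ^ j - 1))) \<and>
          (\<forall>j. primary_part l (A (2 * j)) \<noteq> {\<one>\<^bsub>A (2 * j)\<^esub>} \<longrightarrow>
            card (primary_part l (A (2 * j)))
              = l ^ min (multiplicity l m) (multiplicity l (q ^ (j + 1) - 1)))) \<and>
        (\<forall>j\<ge>1. carrier (A (2 * j - 1)) \<noteq> {\<one>\<^bsub>A (2 * j - 1)\<^esub>} \<longleftrightarrow> gcd m (q ^ j - 1) > 1) \<and>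
        (\<forall>j. carrier (A (2 * j)) \<noteq> {\<one>\<^bsub>A (2 * j)\<^esub>} \<longleftrightarrow> gcd m (q ^ (j + 1) - 1) > 1)))"
proof -
  have "q \<ge> 2"
    using card_mono[of UNIV "{0 :: 'k, 1}"] assms(4) by simp
  note pattern = coefficient_term_pattern[OF assms(1-3) this]
  have rel: "group (relK_group TYPE('k) m n)"
    if "f \<in> iso (relK_group TYPE('k) m n) (principal_term m q n \<times>\<times> additional_term m q n)" for f n
    using that unfolding relK_group_def Let_def
    by (rule group_homotopy_group_if_iso[OF zero_less_Suc
        DirProd_group[OF group_principal_term group_additional_term]])
  show ?thesis
    unfolding Let_def
  proof (rule conjI[OF pattern allI[OF impI[OF pattern]]])
    fix n
    show "group (additional_term m q n)" "additional_term m q n \<cong> additional_term m q n"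
      by (simp_all only: group_additional_term iso_refl)
  next
    fix \<phi> n
    assume "\<forall>n. \<phi> n \<in> iso (relK_group TYPE('k) m n)
      (principal_term m q n \<times>\<times> additional_term m q n)"
    then have \<phi>: "\<phi> n \<in> iso (relK_group TYPE('k) m n)
      (principal_term m q n \<times>\<times> additional_term m q n)" ..
    show "group (second_summand (relK_group TYPE('k) m n) (principal_term m q n) (\<phi> n))"
      "second_summand (relK_group TYPE('k) m n) (principal_term m q n) (\<phi> n)
        \<cong> additional_term m q n"
      by (rule second_summand_iso[OF rel[OF \<phi>] group_principal_term group_additional_term \<phi>])+
  qed
qed

end
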